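(* There is an absolute constant $C>0$ such that for all integers $n\ge 2$ and $q\ge 1$, the number of labelled $n$-vertex intersection graphs of $x$-monotone curves in the plane with chromatic number at most $q$ is at most $2^{C q n\log^2 n}$.
   Context: A curve is a subset of the plane $\mathbb{R}^2$ homeomorphic to the interval $[0,1]$. A curve is $x$-monotone if every vertical line intersects it in at most one point. Two curves are allowed to intersect any number of times. A labelled $n$-vertex intersection graph of $x$-monotone curves is a graph $G$ on the vertex set $\{1,\dots,n\}$ for which there is a collection $\gamma_1,\dots,\gamma_n$ of $x$-monotone curves such that distinct $i,j$ are adjacent in $G$ if and only if $\gamma_i\cap\gamma_j\neq\emptyset$. Labelled graphs are counted as distinct if their edge sets differ. *)

theory Defs
  imports "HOL-Analysis.Analysis"
begin

definition curve :: "(real \<times> real) set \<Rightarrow> bool" where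
  "curve S \<longleftrightarrow> S homeomorphic {0..1::real}"

definition vertical_line :: "real \<Rightarrow> (real \<times> real) set" where
  "vertical_line a = {p. fst p = a}"

definition x_monotone :: "(real \<times> real) set \<Rightarrow> bool" where
  "x_monotone S \<longleftrightarrow>
     (\<forall>a. \<forall>p \<in> S \<inter> vertical_line a. \<forall>q \<in> S \<inter> vertical_line a. p = q)"

text \<open>A labelled simple graph on the vertex set \<open>{1..n}\<close> is identified with its edge set, a set of
  two-element subsets of \<open>{1..n}\<close>.\<close>

definition labelled_graphs :: "nat \<Rightarrow> nat set set set" where
  "labelled_graphs n = Pow {e. e \<subseteq> {1..n} \<and> card e = 2}"

definition x_monotone_intersection_graph :: "nat \<Rightarrow> nat set set \<Rightarrow> bool" where
  "x_monotone_intersection_graph n E \<longleftrightarrow>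
     E \<in> labelled_graphs n \<and>
     (\<exists>\<gamma> :: nat \<Rightarrow> (real \<times> real) set.
        (\<forall>i\<in>{1..n}. curve (\<gamma> i) \<and> x_monotone (\<gamma> i)) \<and>
        (\<forall>i\<in>{1..n}. \<forall>j\<in>{1..n}. i \<noteq> j \<longrightarrow> ({i, j} \<in> E \<longleftrightarrow> \<gamma> i \<inter> \<gamma> j \<noteq> {})))"

definition proper_colouring :: "'a set \<Rightarrow> 'a set set \<Rightarrow> nat \<Rightarrow> ('a \<Rightarrow> nat) \<Rightarrow> bool" where
  "proper_colouring V E k c \<longleftrightarrow>
     c ` V \<subseteq> {..<k} \<and> (\<forall>u\<in>V. \<forall>v\<in>V. {u, v} \<in> E \<longrightarrow> c u \<noteq> c v)"

definition chromatic_number :: "'a set \<Rightarrow> 'a set set \<Rightarrow> nat" where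
  "chromatic_number V E = (LEAST k. \<exists>c. proper_colouring V E k c)"

text \<open>The two facts below show that the least element in \<open>chromatic_number\<close> is taken over a nonempty
  set and that no cardinality of an infinite set is involved in counting labelled graphs.\<close>

lemma finite_labelled_graphs: "finite (labelled_graphs n)"
  unfolding labelled_graphs_def by simp

lemma labelled_graph_colourable:
  assumes "E \<in> labelled_graphs n"
  shows "\<exists>c. proper_colouring {1..n} E (chromatic_number {1..n} E) c"
proof -
  have "proper_colouring {1..n} E (Suc n) id"
    using assms by (auto simp: proper_colouring_def labelled_graphs_def)
  then have "\<exists>k c. proper_colouring {1..n} E k c"
    by blast
  then show ?thesis
    unfolding chromatic_number_def by (rule LeastI_ex)
qed

end

theory Submission imports Defs
begin

text \<open>
  Fix a proper colouring with \<open>q\<close> colours; curves of one colour are pairwise disjoint. The graph is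
  determined by a code that gives each curve its colour and \<open>O(q log n)\<close> numbers of size \<open>O(n)\<close>, that is
  \<open>O(q (log n)\<^sup>2)\<close> bits, and this yields the bound.

  An \<open>x\<close>-monotone curve is the graph of a continuous function on a closed interval
  (\<open>x_monotone_curve_graph\<close>). The endpoints of all these intervals cut the \<open>x\<close>-axis into at most
  \<open>4 n + 1\<close> pieces (the endpoints and the open gaps between them), numbered from left to right. Grouping the
  pieces into dyadic blocks gives a segment tree of depth \<open>O(log n)\<close>, whose nodes are vertical slabs.
  Suppose that two curves meet at a point, and take the largest dyadic slab around this point that is
  spanned by at least one of them. Its parent is spanned by neither curve, so it contains an endpoint of each:
  in the tree, the slab is a child of an ancestor of an endpoint of either curve
  (\<open>common_near_block\<close>). Each curve has at most four such slabs on each level, so it suffices to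
  record, for each curve \<open>b\<close> and each of its \<open>O(log n)\<close> slabs, which of the curves \<open>a\<close>
  spanning that slab are hit by \<open>b\<close> inside it.

  Inside a slab, the curves of one colour that span it are linearly ordered from bottom to top. If
  \<open>b\<close> hits two of them, then by the intermediate value theorem it hits all those in between
  (\<open>middle_graph_hit\<close>). So the set of curves hit by \<open>b\<close> is an interval of this order, given by
  two numbers for each colour (\<open>convex_rank_thresholds\<close>), once every spanning curve has recorded its own
  rank in the slab. Hence every graph in question is decoded from one of the \<open>codes\<close>
  (\<open>coloured_intersection_graph_decode\<close>), and it remains to count these (\<open>card_codes_bound\<close>).
\<close>

section \<open>Dyadic blocks\<close>

definition block :: "nat \<Rightarrow> nat \<Rightarrow> nat set" where
  "block l j = {m. m div 2 ^ l = j}"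

text \<open>In the binary tree whose node \<open>j\<close> on level \<open>l\<close> is \<open>block l j\<close>, these are the children of the
  ancestors of the leaves \<open>u\<close> and \<open>v\<close>; the flags select the leaf and the child. Naming slabs by
  flags instead of by \<open>j\<close> makes the index set of a code the same for all graphs.\<close>

fun near_block :: "nat \<times> nat \<Rightarrow> nat \<Rightarrow> bool \<times> bool \<Rightarrow> nat" where
  "near_block (u, v) l (e, t) = 2 * ((if e then u else v) div 2 ^ Suc l) + of_bool t"

lemma div_between:
  fixes x y z d :: nat
  assumes "x \<le> y" "y \<le> z" "x div d = z div d"
  shows "y div d = z div d"
  using assms by (metis div_le_mono le_antisym)

text \<open>The parent of the block of \<open>m\<close> contains \<open>m\<close>, which lies in the interval, and a number outside
  the interval; being convex, it contains an end of the interval.\<close>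

lemma near_block_exists:
  assumes m: "m \<in> {u..v}" and no: "\<not> block (Suc l) (m div 2 ^ Suc l) \<subseteq> {u..v}"
  shows "\<exists>s. near_block (u, v) l s = m div 2 ^ l"
proof -
  obtain m' where m': "m' div 2 ^ Suc l = m div 2 ^ Suc l" "m' \<notin> {u..v}"
    using no unfolding block_def by blast
  have "u div 2 ^ Suc l = m div 2 ^ Suc l \<or> v div 2 ^ Suc l = m div 2 ^ Suc l"
  proof (cases "m' < u")
    case True
    then show ?thesis
      using m m'(1) div_between[of m' u m "2 ^ Suc l"] by simp
  next
    case False
    then have "v < m'" using m' by auto
    then show ?thesis
      using m m'(1) div_between[of m v m' "2 ^ Suc l"] by simp
  qed
  then obtain e where e: "(if e then u else v) div 2 ^ Suc l = m div 2 ^ Suc l"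
    by (metis (full_types))
  have "m div 2 ^ Suc l = (m div 2 ^ l) div 2"
    by (metis div_mult2_eq power_Suc2)
  moreover have "2 * (x div 2) + of_bool (odd x) = x" for x :: nat
    by (cases "even x") auto
  ultimately have "near_block (u, v) l (e, odd (m div 2 ^ l)) = m div 2 ^ l"
    using e by (simp only: near_block.simps)
  then show ?thesis by blast
qed

text \<open>Climbing from the leaf \<open>m\<close> to the root, take the last block contained in one of the intervals.
  The root is contained in neither because it contains 0. Maximality for both intervals at
  once makes the block near both of them, whichever of them contains it.\<close>

lemma common_near_block:
  assumes ma: "m \<in> {u..v}" and mb: "m \<in> {u'..v'}"
    and pos: "0 < u" "0 < u'" and mK: "m < 2 ^ K"
  shows "\<exists>l<K. \<exists>s t. near_block (u, v) l s = m div 2 ^ l \<and> near_block (u', v') l t = m div 2 ^ l \<and>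
           (block l (m div 2 ^ l) \<subseteq> {u..v} \<or> block l (m div 2 ^ l) \<subseteq> {u'..v'})"
proof -
  define spanned where
    "spanned l \<longleftrightarrow> block l (m div 2 ^ l) \<subseteq> {u..v} \<or> block l (m div 2 ^ l) \<subseteq> {u'..v'}" for l
  have "spanned 0"
    using ma by (auto simp: spanned_def block_def)
  moreover have "\<not> spanned K"
  proof -
    have "0 \<in> block K (m div 2 ^ K)" using mK by (simp add: block_def)
    then show ?thesis using pos by (auto simp: spanned_def)
  qed
  ultimately have "\<exists>l<K. spanned l \<and> \<not> spanned (Suc l)"
    using ex_least_nat_less[of "\<lambda>l. \<not> spanned l" K] by blast
  then obtain l where l: "l < K" "spanned l" "\<not> spanned (Suc l)" by blast
  then show ?thesis
    using near_block_exists[OF ma, of l] near_block_exists[OF mb, of l]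
    unfolding spanned_def by blast
qed

section \<open>Monotone curves as graphs of functions\<close>

text \<open>On such a curve the first projection is injective and continuous, and its inverse is continuous
  because the curve is compact.\<close>

lemma x_monotone_curve_graph:
  assumes "curve S" "x_monotone S"
  shows "\<exists>a b f. a \<le> b \<and> continuous_on {a..b} f \<and> S = (\<lambda>x. (x, f x :: real)) ` {a..b::real}"
proof -
  have "{0..1::real} homeomorphic S"
    using assms(1) unfolding curve_def by (rule homeomorphic_sym[THEN iffD1])
  then obtain h where h: "continuous_on {0..1::real} h" "h ` {0..1} = S"
    unfolding homeomorphic_def homeomorphism_def by blast
  then have cS: "compact S" and conS: "connected S" and ne: "S \<noteq> {}"
    using compact_continuous_image connected_continuous_image by force+
  have inj: "inj_on fst S"
    using assms(2) by (fastforce simp: x_monotone_def vertical_line_def inj_on_def)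
  have "connected (fst ` S)" "compact (fst ` S)"
    using cS conS by (auto intro!: connected_continuous_image compact_continuous_image continuous_intros)
  then obtain a b where ab: "fst ` S = {a..b}"
    using connected_compact_interval_1 by (metis box_real(2))
  define g where "g = the_inv_into S fst"
  have g: "g (fst p) = p" if "p \<in> S" for p
    unfolding g_def using the_inv_into_f_f[OF inj that] .
  have cg: "continuous_on {a..b} g"
    unfolding ab[symmetric] by (rule continuous_on_inv) (use cS g in \<open>auto intro: continuous_intros\<close>)
  have "S = (\<lambda>x. (x, snd (g x))) ` {a..b}"
    unfolding ab[symmetric] image_image using g by (force simp: image_iff)
  moreover have "a \<le> b" using ab ne by auto
  moreover have "continuous_on {a..b} (\<lambda>x. snd (g x))"
    by (intro continuous_intros cg)
  ultimately show ?thesis by (intro exI[of _ a] exI[of _ b] exI[of _ "\<lambda>x. snd (g x)"]) auto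
qed

lemma zero_on_interval:
  fixes T :: "real set" and d :: "real \<Rightarrow> real"
  assumes "is_interval T" "continuous_on T d" "x \<in> T" "y \<in> T" "d x \<le> 0" "0 \<le> d y"
  shows "\<exists>z\<in>T. d z = 0"
proof -
  have "connected (d ` T)"
    using assms by (intro connected_continuous_image) (auto simp: is_interval_connected_1)
  then have "0 \<in> d ` T"
    using assms by (meson connected_contains_Icc atLeastAtMost_iff imageI subsetD)
  then show ?thesis by auto
qed

lemma disjoint_graphs_order:
  fixes S :: "real set" and f g :: "real \<Rightarrow> real"
  assumes "is_interval S" "continuous_on S f" "continuous_on S g"
    and "\<And>x. x \<in> S \<Longrightarrow> f x \<noteq> g x" and "x0 \<in> S" "x \<in> S" "f x0 \<le> g x0"
  shows "f x \<le> g x"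
proof (rule ccontr)
  assume "\<not> f x \<le> g x"
  then have "\<exists>z\<in>S. f z - g z = 0"
    using assms by (intro zero_on_interval[where x = x0 and y = x]) (auto intro: continuous_intros)
  then show False using assms(4) by auto
qed

text \<open>The curve \<open>p\<close> is at or below \<open>g\<close> where it meets \<open>f\<close>, and at or above \<open>g\<close> where it meets
  \<open>h\<close>, since the order of \<open>f\<close>, \<open>g\<close>, \<open>h\<close> is the same at all points of \<open>S\<close>. It may leave \<open>S\<close>
  or end there, so the intermediate value theorem is applied on \<open>S \<inter> J\<close>, which is again an interval.\<close>

lemma middle_graph_hit:
  fixes S J :: "real set" and f g h p :: "real \<Rightarrow> real"
  assumes S: "is_interval S" and J: "is_interval J"
    and cont: "continuous_on S f" "continuous_on S g" "continuous_on S h" "continuous_on J p"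
    and disj: "\<And>x. x \<in> S \<Longrightarrow> f x \<noteq> g x" "\<And>x. x \<in> S \<Longrightarrow> g x \<noteq> h x"
    and x0: "x0 \<in> S" "f x0 \<le> g x0" "g x0 \<le> h x0"
    and x: "x \<in> S \<inter> J" "p x = f x" and y: "y \<in> S \<inter> J" "p y = h y"
  shows "\<exists>z\<in>S \<inter> J. p z = g z"
proof -
  have "f x \<le> g x" "g y \<le> h y"
    using disjoint_graphs_order[of S f g x0 x] disjoint_graphs_order[of S g h x0 y] assms by auto
  then have "\<exists>z\<in>S \<inter> J. p z - g z = 0"
    using x y S J cont
    by (intro zero_on_interval[where x = x and y = y] is_interval_Int)
       (auto intro!: continuous_intros elim: continuous_on_subset)
  then show ?thesis by auto
qed

section \<open>Ranks and positions\<close>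

lemma convex_rank_thresholds:
  fixes rank :: "'a \<Rightarrow> nat"
  assumes "H \<subseteq> A" and bound: "\<And>a. a \<in> A \<Longrightarrow> rank a \<le> n" and "0 < n"
    and convex: "\<And>a b c. a \<in> H \<Longrightarrow> c \<in> H \<Longrightarrow> b \<in> A \<Longrightarrow> rank a \<le> rank b \<Longrightarrow> rank b \<le> rank c \<Longrightarrow> b \<in> H"
  shows "\<exists>lo\<le>n. \<exists>hi\<le>n. \<forall>a\<in>A. a \<in> H \<longleftrightarrow> lo \<le> rank a \<and> rank a \<le> hi"
proof (cases "H = {}")
  case True
  show ?thesis
  proof (intro exI conjI)
    \<comment> \<open>The empty set is cut out by a lower threshold above the upper one.\<close>
    show "1 \<le> n" "0 \<le> n" using \<open>0 < n\<close> by simp_all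
    show "\<forall>a\<in>A. a \<in> H \<longleftrightarrow> 1 \<le> rank a \<and> rank a \<le> 0" using True by simp
  qed
next
  case False
  have fin: "finite (rank ` H)"
    using assms(1) bound by (auto intro!: finite_subset[of "rank ` H" "{..n}"])
  have "Min (rank ` H) \<in> rank ` H" "Max (rank ` H) \<in> rank ` H"
    using fin False by (auto intro!: Min_in Max_in)
  then obtain a c where ac: "a \<in> H" "rank a = Min (rank ` H)" "c \<in> H" "rank c = Max (rank ` H)"
    by (auto simp del: Min_in Max_in)
  have "b \<in> H \<longleftrightarrow> rank a \<le> rank b \<and> rank b \<le> rank c" if "b \<in> A" for b
    using ac convex[of a c b] that fin by auto
  moreover have "rank a \<le> n" "rank c \<le> n" using ac(1,3) assms(1) bound by blast+
  ultimately show ?thesis by blast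
qed

text \<open>Points of \<open>P\<close> get odd numbers and the gaps between them even ones. Closed intervals
  with ends in \<open>P\<close> thereby become intervals of numbers, even where several ends coincide, and number 0
  lies to the left of \<open>P\<close>.\<close>

definition position :: "real set \<Rightarrow> real \<Rightarrow> nat" where
  "position P x = card {p \<in> P. p < x} + card {p \<in> P. p \<le> x}"

lemma position_mono:
  assumes "finite P" "x \<le> y"
  shows "position P x \<le> position P y"
  unfolding position_def using assms by (intro add_mono card_mono) auto

lemma position_less:
  assumes P: "finite P" and "x < y" "x \<in> P \<or> y \<in> P"
  shows "position P x < position P y"
proof -
  have "card {p \<in> P. p < x} \<le> card {p \<in> P. p < y}" "card {p \<in> P. p \<le> x} \<le> card {p \<in> P. p \<le> y}"
    using P \<open>x < y\<close> by (auto intro!: card_mono)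
  moreover have "card {p \<in> P. p < x} < card {p \<in> P. p < y}" if "x \<in> P"
  proof (rule psubset_card_mono)
    have "x \<in> {p \<in> P. p < y} - {p \<in> P. p < x}" using \<open>x < y\<close> that by simp
    moreover have "{p \<in> P. p < x} \<subseteq> {p \<in> P. p < y}" using \<open>x < y\<close> by auto
    ultimately show "{p \<in> P. p < x} \<subset> {p \<in> P. p < y}" by blast
  qed (use P in simp)
  moreover have "card {p \<in> P. p \<le> x} < card {p \<in> P. p \<le> y}" if "y \<in> P"
  proof (rule psubset_card_mono)
    have "y \<in> {p \<in> P. p \<le> y} - {p \<in> P. p \<le> x}" using \<open>x < y\<close> that by simp
    moreover have "{p \<in> P. p \<le> x} \<subseteq> {p \<in> P. p \<le> y}" using \<open>x < y\<close> by auto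
    ultimately show "{p \<in> P. p \<le> x} \<subset> {p \<in> P. p \<le> y}" by blast
  qed (use P in simp)
  ultimately show ?thesis
    using assms(3) unfolding position_def by linarith
qed

lemma position_le_iff:
  assumes "finite P" "x \<in> P \<or> y \<in> P"
  shows "position P x \<le> position P y \<longleftrightarrow> x \<le> y"
  using assms position_mono position_less by (meson linorder_not_less)

lemma position_pos: "finite P \<Longrightarrow> x \<in> P \<Longrightarrow> 0 < position P x"
  by (auto simp: position_def card_gt_0_iff)

lemma position_le: "finite P \<Longrightarrow> position P x \<le> 2 * card P"
  unfolding position_def mult_2 by (intro add_mono card_mono) auto

lemma is_interval_slab:
  assumes "finite P"
  shows "is_interval {x. position P x \<in> block l j}"
  unfolding is_interval_1
proof (intro ballI allI impI)
  fix x z y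
  assume "x \<in> {x. position P x \<in> block l j}" "z \<in> {x. position P x \<in> block l j}" "x \<le> y \<and> y \<le> z"
  then show "y \<in> {x. position P x \<in> block l j}"
    using div_between[of "position P x" "position P y" "position P z" "2 ^ l"] position_mono[OF assms]
    by (simp add: block_def)
qed

section \<open>Codes\<close>

text \<open>A curve carries its colour and the positions of its two endpoints. A curve together with one of its near slabs
  carries its rank at a fixed point of the slab and, for each colour, the two thresholds that
  cut out the curves of this colour hit in the slab.\<close>

type_synonym curve_code = "nat \<times> nat \<times> nat"
type_synonym slab_code = "nat \<times> (nat \<Rightarrow> nat \<times> nat)"

definition codes ::
  "nat \<Rightarrow> nat \<Rightarrow> nat \<Rightarrow> ((nat \<Rightarrow> curve_code) \<times> (nat \<times> nat \<times> bool \<times> bool \<Rightarrow> slab_code)) set" where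
  "codes n q K =
     ({1..n} \<rightarrow>\<^sub>E {..<q} \<times> {..4 * n} \<times> {..4 * n}) \<times>
     ({1..n} \<times> {..<K} \<times> UNIV \<rightarrow>\<^sub>E {..n} \<times> ({..<q} \<rightarrow>\<^sub>E {..n} \<times> {..n}))"

text \<open>Decoding of the event that \<open>a\<close> spans some slab that is near both \<open>a\<close> and \<open>b\<close> and that \<open>b\<close> hits \<open>a\<close>
  there.\<close>

definition code_hit ::
  "nat \<Rightarrow> (nat \<Rightarrow> curve_code) \<Rightarrow> (nat \<times> nat \<times> bool \<times> bool \<Rightarrow> slab_code) \<Rightarrow> nat \<Rightarrow> nat \<Rightarrow> bool" where
  "code_hit K \<kappa> D a b \<longleftrightarrow>
     (\<exists>l<K. \<exists>s t. near_block (snd (\<kappa> a)) l s = near_block (snd (\<kappa> b)) l t \<and>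
        block l (near_block (snd (\<kappa> a)) l s) \<subseteq> {fst (snd (\<kappa> a))..snd (snd (\<kappa> a))} \<and>
        fst (snd (D (b, l, t)) (fst (\<kappa> a))) \<le> fst (D (a, l, s)) \<and>
        fst (D (a, l, s)) \<le> snd (snd (D (b, l, t)) (fst (\<kappa> a))))"

definition decode ::
  "nat \<Rightarrow> nat \<Rightarrow> (nat \<Rightarrow> curve_code) \<times> (nat \<times> nat \<times> bool \<times> bool \<Rightarrow> slab_code) \<Rightarrow> nat set set" where
  "decode n K = (\<lambda>(\<kappa>, D). {{a, b} | a b. a \<in> {1..n} \<and> b \<in> {1..n} \<and> a \<noteq> b \<and> code_hit K \<kappa> D a b})"

lemma card_codes:
  "card (codes n q K) = (q * (4 * n + 1)\<^sup>2) ^ n * ((n + 1) ^ (2 * q + 1)) ^ (4 * n * K)"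
proof -
  have "card (UNIV :: (bool \<times> bool) set) = 4"
    by (simp add: card_cartesian_product flip: UNIV_Times_UNIV)
  then have "card (codes n q K) =
      (q * ((4 * n + 1) * (4 * n + 1))) ^ n * ((n + 1) * ((n + 1) * (n + 1)) ^ q) ^ (n * (K * 4))"
    by (simp add: codes_def card_cartesian_product card_PiE)
  also have "n * (K * 4) = 4 * n * K"
    by simp
  also have "(n + 1) * ((n + 1) * (n + 1)) ^ q = (n + 1) ^ (2 * q + 1)"
    by (simp only: Suc_eq_plus1[symmetric] power_Suc power_mult power2_eq_square)
  finally show ?thesis
    by (simp only: power2_eq_square)
qed

lemma finite_codes: "finite (codes n q K)"
  unfolding codes_def by (intro finite_cartesian_product finite_PiE) auto

text \<open>The choice of \<open>K\<close> makes all positions smaller than \<open>2 ^ K\<close>, so that level \<open>K\<close> is the root of the tree.\<close>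

lemma coloured_intersection_graph_decode:
  assumes G: "x_monotone_intersection_graph n E" and col: "proper_colouring {1..n} E k c"
    and "k \<le> q" and K: "4 * n < 2 ^ K"
  shows "E \<in> decode n K ` codes n q K"
proof -
  obtain \<gamma> where \<gamma>: "\<And>i. i \<in> {1..n} \<Longrightarrow> curve (\<gamma> i) \<and> x_monotone (\<gamma> i)"
    and E: "\<And>i j. i \<in> {1..n} \<Longrightarrow> j \<in> {1..n} \<Longrightarrow> i \<noteq> j \<Longrightarrow> {i, j} \<in> E \<longleftrightarrow> \<gamma> i \<inter> \<gamma> j \<noteq> {}"
    using G unfolding x_monotone_intersection_graph_def by blast
  have "\<forall>i\<in>{1..n}. \<exists>a b f. a \<le> b \<and> continuous_on {a..b} f \<and> \<gamma> i = (\<lambda>x. (x, f x)) ` {a..b}"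
    using \<gamma> x_monotone_curve_graph by blast
  then obtain a b f where ab: "\<And>i. i \<in> {1..n} \<Longrightarrow> a i \<le> b i"
    and cont: "\<And>i. i \<in> {1..n} \<Longrightarrow> continuous_on {a i..b i} (f i)"
    and gr: "\<And>i. i \<in> {1..n} \<Longrightarrow> \<gamma> i = (\<lambda>x. (x, f i x)) ` {a i..b i}"
    by metis
  have meet: "{i, j} \<in> E \<longleftrightarrow> (\<exists>x\<in>{a i..b i} \<inter> {a j..b j}. f i x = f j x)"
    if "i \<in> {1..n}" "j \<in> {1..n}" "i \<noteq> j" for i j
    unfolding E[OF that] gr[OF that(1)] gr[OF that(2)] by fastforce
  have c: "c i < q" if "i \<in> {1..n}" for i
  proof -
    have "c i \<in> {..<k}"
      using col that unfolding proper_colouring_def by blast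
    then show ?thesis using \<open>k \<le> q\<close> by simp
  qed
  have disj: "f i x \<noteq> f j x"
    if "i \<in> {1..n}" "j \<in> {1..n}" "i \<noteq> j" "c i = c j" "x \<in> {a i..b i}" "x \<in> {a j..b j}" for i j x
  proof -
    have "{i, j} \<notin> E"
      using col that(1,2,4) unfolding proper_colouring_def by blast
    then show ?thesis using meet[OF that(1-3)] that(5,6) by blast
  qed

  define P where "P = a ` {1..n} \<union> b ` {1..n}"
  have P: "finite P" "\<And>i. i \<in> {1..n} \<Longrightarrow> a i \<in> P \<and> b i \<in> P"
    by (auto simp: P_def)
  have "card P \<le> 2 * n"
    using card_Un_le[of "a ` {1..n}" "b ` {1..n}"] card_image_le[of "{1..n}" a]
      card_image_le[of "{1..n}" b] by (simp add: P_def)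
  then have pos_le: "position P x \<le> 4 * n" for x
    using position_le[OF P(1), of x] by linarith
  define u where "u i = position P (a i)" for i
  define v where "v i = position P (b i)" for i
  have inI: "position P x \<in> {u i..v i} \<longleftrightarrow> x \<in> {a i..b i}" if "i \<in> {1..n}" for i x
    using position_le_iff[OF P(1)] P(2)[OF that] by (auto simp: u_def v_def)

  define slab where "slab l j = {x. position P x \<in> block l j}" for l j
  define probe where "probe l j = (SOME x. x \<in> slab l j)" for l j
  have probe: "probe l j \<in> slab l j" if "x \<in> slab l j" for x l j
    unfolding probe_def using that by (rule someI)
  \<comment> \<open>The rank counts all curves, whatever their colour and extent: the values \<open>f i'\<close> outside the
    domains are arbitrary, but only monotonicity of the rank in \<open>f i (probe l j)\<close> matters.\<close>
  define rank where "rank l j i = card {i' \<in> {1..n}. f i' (probe l j) < f i (probe l j)}" for l j i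
  have rank_le: "rank l j i \<le> n" for l j i
  proof -
    have "rank l j i \<le> card {1..n}"
      unfolding rank_def by (rule card_mono) auto
    then show ?thesis by simp
  qed
  have rank_mono: "f i (probe l j) \<le> f i' (probe l j)"
    if "rank l j i \<le> rank l j i'" "i' \<in> {1..n}" for l j i i'
  proof (rule ccontr)
    assume "\<not> ?thesis"
    then have less: "f i' (probe l j) < f i (probe l j)" by simp
    have "rank l j i' < rank l j i"
      unfolding rank_def
    proof (rule psubset_card_mono)
      let ?below = "\<lambda>i. {i' \<in> {1..n}. f i' (probe l j) < f i (probe l j)}"
      have "i' \<in> ?below i - ?below i'" using less that(2) by simp
      moreover have "?below i' \<subseteq> ?below i" using less by auto
      ultimately show "?below i' \<subset> ?below i" by blast
    qed simp
    then show False using that by simp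
  qed
  define span where "span l j d = {i \<in> {1..n}. c i = d \<and> block l j \<subseteq> {u i..v i}}" for l j d
  have slab_sub: "slab l j \<subseteq> {a i..b i}" if "i \<in> span l j d" for l j d i
    using that inI[of i] unfolding span_def slab_def by blast
  define hit where
    "hit l j d i = {i' \<in> span l j d. \<exists>x\<in>slab l j \<inter> {a i..b i}. f i x = f i' x}" for l j d i
  have hit_convex: "i2 \<in> hit l j d i"
    if i: "i \<in> {1..n}" and "i1 \<in> hit l j d i" "i3 \<in> hit l j d i" "i2 \<in> span l j d"
      "rank l j i1 \<le> rank l j i2" "rank l j i2 \<le> rank l j i3" for l j d i i1 i2 i3
  proof (cases "i2 = i1 \<or> i2 = i3")
    case True
    then show ?thesis using that by auto
  next
    case False
    note hits = that
    have sp: "i1 \<in> span l j d" "i2 \<in> span l j d" "i3 \<in> span l j d"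
      using that by (auto simp: hit_def)
    then have V: "i1 \<in> {1..n}" "i2 \<in> {1..n}" "i3 \<in> {1..n}" "c i1 = c i2" "c i2 = c i3"
      by (auto simp: span_def)
    obtain x y where x: "x \<in> slab l j \<inter> {a i..b i}" "f i x = f i1 x"
      and y: "y \<in> slab l j \<inter> {a i..b i}" "f i y = f i3 y"
      using hits(2,3) unfolding hit_def by blast
    have "\<exists>z\<in>slab l j \<inter> {a i..b i}. f i z = f i2 z"
    proof (rule middle_graph_hit[where f = "f i1" and h = "f i3" and ?x0.0 = "probe l j" and x = x and y = y])
      show "is_interval (slab l j)"
        unfolding slab_def by (rule is_interval_slab[OF P(1)])
      show "continuous_on (slab l j) (f i1)" "continuous_on (slab l j) (f i2)"
        "continuous_on (slab l j) (f i3)"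
        by (rule continuous_on_subset[OF cont[OF V(1)] slab_sub[OF sp(1)]],
            rule continuous_on_subset[OF cont[OF V(2)] slab_sub[OF sp(2)]],
            rule continuous_on_subset[OF cont[OF V(3)] slab_sub[OF sp(3)]])
      show "f i1 z \<noteq> f i2 z" if "z \<in> slab l j" for z
        by (rule disj) (use that False V slab_sub[OF sp(1)] slab_sub[OF sp(2)] in blast)+
      show "f i2 z \<noteq> f i3 z" if "z \<in> slab l j" for z
        by (rule disj) (use that False V slab_sub[OF sp(2)] slab_sub[OF sp(3)] in blast)+
      show "probe l j \<in> slab l j"
        using probe x(1) by blast
      show "f i1 (probe l j) \<le> f i2 (probe l j)" "f i2 (probe l j) \<le> f i3 (probe l j)"
        using rank_mono[OF hits(5) V(2)] rank_mono[OF hits(6) V(3)] .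
    qed (use x y cont[OF i] in \<open>simp_all only: is_interval_cc\<close>)
    then show ?thesis using sp(2) by (simp add: hit_def)
  qed
  have "\<exists>t. fst t \<le> n \<and> snd t \<le> n \<and>
          (\<forall>i'\<in>span l j d. i' \<in> hit l j d i \<longleftrightarrow> fst t \<le> rank l j i' \<and> rank l j i' \<le> snd t)"
    if i: "i \<in> {1..n}" for l j d i
  proof -
    have "\<exists>lo\<le>n. \<exists>hi\<le>n. \<forall>i'\<in>span l j d. i' \<in> hit l j d i \<longleftrightarrow> lo \<le> rank l j i' \<and> rank l j i' \<le> hi"
    proof (rule convex_rank_thresholds)
      show "hit l j d i \<subseteq> span l j d" unfolding hit_def by blast
      show "0 < n" using i by simp
    qed (use rank_le hit_convex[OF i] in blast)+
    then obtain lo hi where "lo \<le> n" "hi \<le> n"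
      "\<forall>i'\<in>span l j d. i' \<in> hit l j d i \<longleftrightarrow> lo \<le> rank l j i' \<and> rank l j i' \<le> hi"
      by blast
    then show ?thesis by (intro exI[of _ "(lo, hi)"]) simp
  qed
  then have "\<forall>i l j d. \<exists>t. i \<in> {1..n} \<longrightarrow> fst t \<le> n \<and> snd t \<le> n \<and>
          (\<forall>i'\<in>span l j d. i' \<in> hit l j d i \<longleftrightarrow> fst t \<le> rank l j i' \<and> rank l j i' \<le> snd t)"
    by blast
  then obtain th where th_all: "\<forall>i l j d. i \<in> {1..n} \<longrightarrow> fst (th i l j d) \<le> n \<and> snd (th i l j d) \<le> n \<and>
      (\<forall>i'\<in>span l j d. i' \<in> hit l j d i \<longleftrightarrow>
        fst (th i l j d) \<le> rank l j i' \<and> rank l j i' \<le> snd (th i l j d))"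
    unfolding choice_iff by blast
  then have th: "fst (th i l j d) \<le> n" "snd (th i l j d) \<le> n"
    and th_hit: "i' \<in> span l j d \<Longrightarrow> i' \<in> hit l j d i \<longleftrightarrow>
      fst (th i l j d) \<le> rank l j i' \<and> rank l j i' \<le> snd (th i l j d)"
    if "i \<in> {1..n}" for i l j d i'
    using that by blast+

  define \<kappa> where "\<kappa> = (\<lambda>i\<in>{1..n}. (c i, u i, v i))"
  define D where "D = (\<lambda>(i, l, s)\<in>{1..n} \<times> {..<K} \<times> UNIV.
    (rank l (near_block (u i, v i) l s) i, \<lambda>d\<in>{..<q}. th i l (near_block (u i, v i) l s) d))"
  have \<kappa>_eq: "\<kappa> i = (c i, u i, v i)" if "i \<in> {1..n}" for i
    using that by (simp add: \<kappa>_def)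
  have D_eq: "D (i, l, s) = (rank l (near_block (u i, v i) l s) i,
      \<lambda>d\<in>{..<q}. th i l (near_block (u i, v i) l s) d)" if "i \<in> {1..n}" "l < K" for i l s
    using that by (simp add: D_def)
  have "\<kappa> \<in> {1..n} \<rightarrow>\<^sub>E {..<q} \<times> {..4 * n} \<times> {..4 * n}"
    unfolding \<kappa>_def using c pos_le by (auto simp: u_def v_def)
  moreover have "D \<in> {1..n} \<times> {..<K} \<times> UNIV \<rightarrow>\<^sub>E {..n} \<times> ({..<q} \<rightarrow>\<^sub>E {..n} \<times> {..n})"
  proof (rule PiE_I)
    fix x assume "x \<in> {1..n} \<times> {..<K} \<times> (UNIV :: (bool \<times> bool) set)"
    then obtain i l s where x: "x = (i, l, s)" and i: "i \<in> {1..n}" and l: "l < K"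
      by blast
    have "(\<lambda>d\<in>{..<q}. th i l j d) \<in> {..<q} \<rightarrow>\<^sub>E {..n} \<times> {..n}" for j
      by (rule restrict_PiE_iff[THEN iffD2]) (use th[OF i] in \<open>simp add: mem_Times_iff\<close>)
    then show "D x \<in> {..n} \<times> ({..<q} \<rightarrow>\<^sub>E {..n} \<times> {..n})"
      unfolding x D_eq[OF i l] using rank_le by blast
  next
    fix x assume "x \<notin> {1..n} \<times> {..<K} \<times> (UNIV :: (bool \<times> bool) set)"
    then show "D x = undefined"
      unfolding D_def by (rule restrict_apply[THEN trans, OF if_not_P])
  qed
  ultimately have in_codes: "(\<kappa>, D) \<in> codes n q K"
    by (simp add: codes_def)
  have code_hit: "code_hit K \<kappa> D i i' \<longleftrightarrow>
      (\<exists>l<K. \<exists>s t. near_block (u i, v i) l s = near_block (u i', v i') l t \<and>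
        i \<in> hit l (near_block (u i, v i) l s) (c i) i')"
    if i: "i \<in> {1..n}" and i': "i' \<in> {1..n}" for i i'
  proof -
    have thresholds: "block l j \<subseteq> {u i..v i} \<and> fst (th i' l j (c i)) \<le> rank l j i \<and>
        rank l j i \<le> snd (th i' l j (c i)) \<longleftrightarrow> i \<in> hit l j (c i) i'" for l j
    proof (cases "i \<in> span l j (c i)")
      case True
      then show ?thesis using th_hit[OF i' True] by (simp add: span_def)
    next
      case False
      then show ?thesis using i by (simp add: span_def hit_def)
    qed
    show ?thesis
      unfolding code_hit_def \<kappa>_eq[OF i] \<kappa>_eq[OF i'] fst_conv snd_conv
      by (intro ex_cong1 conj_cong refl)
         (simp add: D_eq[OF i] D_eq[OF i'] c[OF i] thresholds[symmetric] del: near_block.simps)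
  qed
  have code_hit_meet: "{i, i'} \<in> E"
    if V: "i \<in> {1..n}" "i' \<in> {1..n}" "i \<noteq> i'" and coded: "code_hit K \<kappa> D i i'" for i i'
  proof -
    obtain l j where "i \<in> hit l j (c i) i'"
      using code_hit[OF V(1,2)] coded by blast
    then obtain x where "i \<in> span l j (c i)" "x \<in> slab l j" "x \<in> {a i'..b i'}" "f i' x = f i x"
      unfolding hit_def by blast
    moreover from this have "x \<in> {a i..b i}"
      using slab_sub by blast
    ultimately show ?thesis
      unfolding meet[OF V] by (intro bexI[of _ x]) auto
  qed
  have meet_code_hit: "code_hit K \<kappa> D i i' \<or> code_hit K \<kappa> D i' i"
    if V: "i \<in> {1..n}" "i' \<in> {1..n}" "i \<noteq> i'" and "{i, i'} \<in> E" for i i'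
  proof -
    obtain x where x: "x \<in> {a i..b i}" "x \<in> {a i'..b i'}" "f i x = f i' x"
      using \<open>{i, i'} \<in> E\<close> unfolding meet[OF V] by blast
    define m where "m = position P x"
    have "m < 2 ^ K"
      using pos_le[of x] K by (simp add: m_def)
    moreover have "m \<in> {u i..v i}" "m \<in> {u i'..v i'}"
      unfolding m_def inI[OF V(1)] inI[OF V(2)] using x by simp_all
    moreover have "0 < u i" "0 < u i'"
      unfolding u_def using position_pos[OF P(1)] P(2) V by simp_all
    ultimately obtain l s t where l: "l < K" and s: "near_block (u i, v i) l s = m div 2 ^ l"
      and t: "near_block (u i', v i') l t = m div 2 ^ l"
      and sp: "block l (m div 2 ^ l) \<subseteq> {u i..v i} \<or> block l (m div 2 ^ l) \<subseteq> {u i'..v i'}"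
      using common_near_block[of m "u i" "v i" "u i'" "v i'" K] by blast
    have "x \<in> slab l (m div 2 ^ l)"
      by (simp add: slab_def block_def m_def)
    then have x_i: "\<exists>x\<in>slab l (m div 2 ^ l) \<inter> {a i'..b i'}. f i' x = f i x"
      and x_i': "\<exists>x\<in>slab l (m div 2 ^ l) \<inter> {a i..b i}. f i x = f i' x"
      using x by (intro bexI[of _ x]; simp)+
    from sp show ?thesis
    proof
      assume "block l (m div 2 ^ l) \<subseteq> {u i..v i}"
      then have "i \<in> hit l (m div 2 ^ l) (c i) i'"
        unfolding hit_def span_def using V(1) x_i by blast
      then have "code_hit K \<kappa> D i i'"
        unfolding code_hit[OF V(1,2)]
        by (intro exI[of _ l] conjI l exI[of _ s] exI[of _ t]) (simp_all only: s t)
      then show ?thesis ..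
    next
      assume "block l (m div 2 ^ l) \<subseteq> {u i'..v i'}"
      then have "i' \<in> hit l (m div 2 ^ l) (c i') i"
        unfolding hit_def span_def using V(2) x_i' by blast
      then have "code_hit K \<kappa> D i' i"
        unfolding code_hit[OF V(2,1)]
        by (intro exI[of _ l] conjI l exI[of _ t] exI[of _ s]) (simp_all only: s t)
      then show ?thesis ..
    qed
  qed
  have "E = decode n K (\<kappa>, D)"
  proof (intro equalityI subsetI)
    fix e assume "e \<in> E"
    moreover have "e \<subseteq> {1..n} \<and> card e = 2"
      using G \<open>e \<in> E\<close> unfolding x_monotone_intersection_graph_def labelled_graphs_def by blast
    then obtain i i' where e: "e = {i, i'}" "i \<noteq> i'" "i \<in> {1..n}" "i' \<in> {1..n}"
      unfolding card_2_iff by blast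
    ultimately have "code_hit K \<kappa> D i i' \<or> code_hit K \<kappa> D i' i"
      using meet_code_hit by blast
    then show "e \<in> decode n K (\<kappa>, D)"
      using e unfolding decode_def by blast
  next
    fix e assume "e \<in> decode n K (\<kappa>, D)"
    then show "e \<in> E" using code_hit_meet unfolding decode_def by blast
  qed
  then show ?thesis using in_codes by blast
qed

section \<open>Counting\<close>

text \<open>Each of the numbers \<open>4 n + 1\<close>, \<open>n + 1\<close> and \<open>K\<close> is replaced by its crude bound in terms of
  \<open>L = log 2 n \<ge> 1\<close>. The curves contribute the exponent \<open>(q + 8 L) n \<le> 9 q n L\<^sup>2\<close> and the slabs
  \<open>96 q n L\<^sup>2\<close>.\<close>

lemma card_codes_bound:
  assumes n: "2 \<le> n" and q: "1 \<le> q" and K: "real K \<le> log 2 n + 3"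
  shows "real (card (codes n q K)) \<le> 2 powr (105 * real q * real n * (log 2 n)\<^sup>2)"
proof -
  define L where "L = log 2 n"
  have L: "1 \<le> L" using n by (simp add: L_def le_log_iff)
  have pw: "(2 powr y) ^ k = 2 powr (y * real k)" for y :: real and k :: nat
    by (simp add: powr_power mult.commute)
  have nL: "real n = 2 powr L" using n by (simp add: L_def)
  have qb: "real q \<le> 2 powr q"
    using less_exp[of q] by (simp add: powr_realpow)
  have "real (4 * n + 1) \<le> 2 powr 3 * 2 powr L"
    using n by (simp add: nL[symmetric])
  also have "\<dots> \<le> 2 powr (4 * L)"
    unfolding powr_add[symmetric] using L by (intro powr_mono) auto
  finally have "real (4 * n + 1) ^ 2 \<le> (2 powr (4 * L)) ^ 2"
    by (intro power_mono) auto
  then have "(real q * real (4 * n + 1) ^ 2) ^ n \<le> (2 powr q * 2 powr (8 * L)) ^ n"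
    using qb by (intro power_mono mult_mono) (auto simp: powr_power mult_ac)
  also have "\<dots> = 2 powr ((q + 8 * L) * n)"
    by (simp add: powr_power mult.commute flip: powr_add)
  finally have 1: "(real q * real (4 * n + 1) ^ 2) ^ n \<le> 2 powr ((q + 8 * L) * n)" .
  have "real (n + 1) \<le> 2 powr 1 * 2 powr L"
    using n by (simp add: nL[symmetric])
  also have "\<dots> \<le> 2 powr (2 * L)"
    unfolding powr_add[symmetric] using L by (intro powr_mono) auto
  finally have "(real (n + 1) ^ (2 * q + 1)) ^ (4 * n * K) \<le> ((2 powr (2 * L)) ^ (2 * q + 1)) ^ (4 * n * K)"
    by (intro power_mono) auto
  also have "\<dots> = 2 powr (2 * L * (2 * q + 1) * (4 * n * K))"
    unfolding pw by simp
  finally have 2: "(real (n + 1) ^ (2 * q + 1)) ^ (4 * n * K) \<le> 2 powr (2 * L * (2 * q + 1) * (4 * n * K))" .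
  have "real (card (codes n q K)) = (real q * real (4 * n + 1) ^ 2) ^ n * (real (n + 1) ^ (2 * q + 1)) ^ (4 * n * K)"
    by (simp only: card_codes of_nat_mult of_nat_power)
  also have "\<dots> \<le> 2 powr ((q + 8 * L) * n) * 2 powr (2 * L * (2 * q + 1) * (4 * n * K))"
    by (rule mult_mono[OF 1 2]) auto
  also have "\<dots> = 2 powr ((q + 8 * L) * n + 2 * L * (2 * q + 1) * (4 * n * K))"
    by (simp add: powr_add)
  also have "\<dots> \<le> 2 powr (105 * real q * real n * L\<^sup>2)"
  proof (rule powr_mono)
    have LL: "L \<le> L\<^sup>2" "1 \<le> L\<^sup>2" using L by (auto simp: one_le_power intro: self_le_power)
    have "q + 8 * L \<le> 9 * q * L\<^sup>2"
    proof -
      have "real q * 1 \<le> real q * L\<^sup>2"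
        using LL(2) by (rule mult_left_mono) simp
      moreover have "1 * L \<le> real q * L\<^sup>2"
        by (rule mult_mono) (use LL L q in auto)
      ultimately show ?thesis by simp
    qed
    then have a: "(q + 8 * L) * n \<le> 9 * q * L\<^sup>2 * n"
      by (intro mult_right_mono) auto
    have K4: "real K \<le> 4 * L"
      using K L by (simp add: L_def)
    have "2 * L * (2 * q + 1) * (4 * n * K) \<le> 2 * L * (3 * q) * (4 * n * (4 * L))"
      using q L mult_left_mono[OF K4, of "4 * real n"]
      by (intro mult_mono) (auto simp: mult.assoc)
    also have "\<dots> = 96 * q * L\<^sup>2 * n"
      by (simp add: power2_eq_square)
    finally show "(q + 8 * L) * n + 2 * L * (2 * q + 1) * (4 * n * K) \<le> 105 * real q * real n * L\<^sup>2"
      using a by (simp add: algebra_simps)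
  qed simp
  finally show ?thesis by (simp add: L_def)
qed

theorem corollary1p5:
  "\<exists>C::real. C > 0 \<and>
     (\<forall>n q :: nat. n \<ge> 2 \<longrightarrow> q \<ge> 1 \<longrightarrow>
        real (card {E. x_monotone_intersection_graph n E \<and> chromatic_number {1..n} E \<le> q})
          \<le> 2 powr (C * real q * real n * (log 2 (real n))\<^sup>2))"
proof (intro exI[of _ 105] conjI allI impI)
  fix n q :: nat
  assume n: "2 \<le> n" and q: "1 \<le> q"
  define K where "K = nat \<lfloor>log 2 n\<rfloor> + 3"
  have L: "0 \<le> log 2 n" using n by simp
  then have K_le: "real K \<le> log 2 n + 3"
    by (simp add: K_def)
  have "log 2 n + 2 < real K"
    using L by (simp add: K_def) linarith
  then have "2 powr (log 2 n + 2) < 2 powr real K"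
    by simp
  then have "real (4 * n) < real (2 ^ K)"
    using n by (simp add: powr_add powr_realpow)
  then have K: "4 * n < 2 ^ K"
    by (simp only: of_nat_less_iff)
  have "{E. x_monotone_intersection_graph n E \<and> chromatic_number {1..n} E \<le> q} \<subseteq> decode n K ` codes n q K"
  proof
    fix E assume "E \<in> {E. x_monotone_intersection_graph n E \<and> chromatic_number {1..n} E \<le> q}"
    then have G: "x_monotone_intersection_graph n E" and chi: "chromatic_number {1..n} E \<le> q"
      by simp_all
    have "E \<in> labelled_graphs n"
      using G by (simp add: x_monotone_intersection_graph_def)
    then obtain c where "proper_colouring {1..n} E (chromatic_number {1..n} E) c"
      using labelled_graph_colourable by blast
    then show "E \<in> decode n K ` codes n q K"
      using coloured_intersection_graph_decode[OF G _ chi K] by simp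
  qed
  then have "card {E. x_monotone_intersection_graph n E \<and> chromatic_number {1..n} E \<le> q} \<le> card (codes n q K)"
    using finite_codes by (meson card_image_le card_mono finite_imageI order_trans)
  then show "real (card {E. x_monotone_intersection_graph n E \<and> chromatic_number {1..n} E \<le> q})
      \<le> 2 powr (105 * real q * real n * (log 2 (real n))\<^sup>2)"
    using card_codes_bound[OF n q K_le] by linarith
qed simp

end
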